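(* Let $$\Theta=\begin{bmatrix}\Theta_{11}&0&\Theta_{13}\\0&\Theta_{22}&0\\ \Theta_{13}&0&\Theta_{33}\end{bmatrix}$$ be a real symmetric matrix, and assume that $\Theta$ is indefinite. Let $$\mathcal{C}(\Theta)=\{z=x+\mathrm{j}y\in\mathbb{C}_+ : \Theta_{11}x^2+\Theta_{22}y^2+2\Theta_{13}x+\Theta_{33}\le 0\}.$$ Then $\mathcal{C}(\Theta)$ is h-convex if and only if $\Theta_{11}\ge\Theta_{22}$.
   Context: $\mathbb{C}_+=\{z\in\mathbb{C}:\mathrm{Im}\{z\}>0\}$ is the open upper half-plane, regarded as the Poincaré half-plane model of the hyperbolic plane: the geodesic connecting two points is the vertical segment between them if they have equal real parts, and otherwise the arc between them of the circle through both points centered on the real axis. A set $\mathcal{R}\subset\mathbb{C}_+$ is hyperbolically convex (h-convex) if for every pair of points in $\mathcal{R}$ the geodesic connecting them lies in $\mathcal{R}$. A real symmetric matrix is indefinite if it has at least one positive and at least one negative eigenvalue. *)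

theory Defs
  imports
    "HOL-Analysis.Line_Segment"
    "Jordan_Normal_Form.Char_Poly"
begin

definition upper_half_plane :: "complex set" where
  "upper_half_plane = {z. 0 < Im z}"

text \<open>A circle centered on the real axis meets the upper half-plane in a semicircle on which the
  real part is injective. Hence the arc between \<open>z\<close> and \<open>w\<close> consists of the points of this
  semicircle whose real part lies between those of \<open>z\<close> and \<open>w\<close>. If the real parts of \<open>z\<close> and \<open>w\<close>
  differ, the center \<open>c\<close> and the radius \<open>r\<close> are determined by \<open>z\<close> and \<open>w\<close>. The definition is
  meaningful for \<open>z\<close>, \<open>w\<close> in the upper half-plane only; for \<open>z = w\<close> it yields \<open>{z}\<close>.\<close>

definition hgeodesic :: "complex \<Rightarrow> complex \<Rightarrow> complex set" where
  "hgeodesic z w =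
     (if Re z = Re w then closed_segment z w
      else {p \<in> upper_half_plane. Re p \<in> closed_segment (Re z) (Re w) \<and>
              (\<exists>(c::real) r. {z, w, p} \<subseteq> sphere (complex_of_real c) r)})"

definition hconvex :: "complex set \<Rightarrow> bool" where
  "hconvex R \<longleftrightarrow>
     R \<subseteq> upper_half_plane \<and> (\<forall>z\<in>R. \<forall>w\<in>R. hgeodesic z w \<subseteq> R)"

definition indefinite :: "real mat \<Rightarrow> bool" where
  "indefinite A \<longleftrightarrow>
     transpose_mat A = A \<and>
     (\<exists>k. eigenvalue A k \<and> 0 < k) \<and> (\<exists>k. eigenvalue A k \<and> k < 0)"

text \<open>Matrix indices start at 0, so that \<open>\<Theta> $$ (i - 1, j - 1)\<close> is the entry written \<open>\<Theta>\<^sub>i\<^sub>j\<close>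
  when rows and columns are numbered from 1.\<close>

definition C_region :: "real mat \<Rightarrow> complex set" where
  "C_region \<Theta> =
     {z \<in> upper_half_plane.
        \<Theta> $$ (0, 0) * (Re z)\<^sup>2 + \<Theta> $$ (1, 1) * (Im z)\<^sup>2
          + 2 * \<Theta> $$ (0, 2) * Re z + \<Theta> $$ (2, 2) \<le> 0}"

end

(* On the geodesic (x - c)^2 + y^2 = r^2 the defining function of the region is a quadratic
   polynomial in x with leading coefficient \<theta>11 - \<theta>22, and on a vertical geodesic it is monotone
   in y. So \<theta>11 \<ge> \<theta>22 makes every sublevel set connected along geodesics. If \<theta>11 < \<theta>22, the
   polynomial is strictly concave; indefiniteness supplies a point of the boundary curve (or, for
   \<theta>22 = 0, a vertical line outside the region), and the geodesic that is tangent to the curve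
   there, slightly perturbed, leaves the region and comes back. *)

theory Submission
  imports Defs
begin

text \<open>Averaging the circle equation over the two end points eliminates the center and gives
  the squared height above the midpoint \<open>m\<close> of their real parts. A violation of
  convexity can thus be tested at one explicit point.\<close>

lemma hconvex_midpoint:
  assumes "hconvex R" and "Complex (m - t) u \<in> R" and "Complex (m + t) v \<in> R" and "0 < t"
  shows "Complex m (sqrt ((u\<^sup>2 + v\<^sup>2) / 2 + t\<^sup>2)) \<in> R"
proof -
  \<comment> \<open>The center is the real point equidistant from both end points.\<close>
  define c where "c = m - (u\<^sup>2 - v\<^sup>2) / (4 * t)"
  define r where "r = sqrt ((m - t - c)\<^sup>2 + u\<^sup>2)"
  define w where "w = (u\<^sup>2 + v\<^sup>2) / 2 + t\<^sup>2"
  have w: "0 < w"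
    using \<open>0 < t\<close> by (simp add: w_def add_nonneg_pos)
  have c: "4 * (t * (m - c)) = u\<^sup>2 - v\<^sup>2"
    using \<open>0 < t\<close> by (simp add: c_def)
  have 1: "(m + t - c)\<^sup>2 + v\<^sup>2 = (m - t - c)\<^sup>2 + u\<^sup>2"
    using c by (simp add: power2_eq_square algebra_simps)
  have 2: "(m - c)\<^sup>2 + w = (m - t - c)\<^sup>2 + u\<^sup>2"
    using c unfolding w_def by (simp add: power2_eq_square field_simps)
  have sphere: "Complex x y \<in> sphere (complex_of_real c) r"
    if "(x - c)\<^sup>2 + y\<^sup>2 = (m - t - c)\<^sup>2 + u\<^sup>2" for x y
    using that by (simp add: dist_norm cmod_def r_def power2_commute[of c])
  have "{Complex (m - t) u, Complex (m + t) v, Complex m (sqrt w)} \<subseteq> sphere (complex_of_real c) r"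
    using w 1 2 by (intro insert_subsetI empty_subsetI sphere) simp_all
  then have "Complex m (sqrt w) \<in> hgeodesic (Complex (m - t) u) (Complex (m + t) v)"
    unfolding hgeodesic_def upper_half_plane_def
    using \<open>0 < t\<close> w by (auto simp: closed_segment_eq_real_ivl simp del: mem_sphere)
  with assms show ?thesis
    unfolding hconvex_def w_def by blast
qed

lemma sublevel_hconvex:
  fixes a b d e :: real
  assumes "d \<le> a"
  shows "hconvex {z \<in> upper_half_plane. a * (Re z)\<^sup>2 + d * (Im z)\<^sup>2 + 2 * b * Re z + e \<le> 0}"
    (is "hconvex {z \<in> upper_half_plane. ?f z \<le> 0}")
  unfolding hconvex_def
proof (intro conjI ballI subsetI; (elim CollectE conjE)?)
  fix z w p
  assume z: "z \<in> upper_half_plane" "?f z \<le> 0" and w: "w \<in> upper_half_plane" "?f w \<le> 0"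
    and p: "p \<in> hgeodesic z w"
  have "p \<in> upper_half_plane \<and> ?f p \<le> 0"
  proof (cases "Re z = Re w")
    case True
    then have "p \<in> closed_segment z w"
      using p by (simp add: hgeodesic_def)
    then have "Re p = Re z" and Im: "Im p \<in> closed_segment (Im z) (Im w)"
      using True by (auto simp: closed_segment_same_Re)
    moreover have "0 < Im p"
      using Im z(1) w(1)
      by (auto simp: closed_segment_eq_real_ivl upper_half_plane_def split: if_splits)
    \<comment> \<open>The upper end point dominates for \<open>0 \<le> d\<close>, the lower one for
      \<open>d < 0\<close>.\<close>
    moreover have "d * (Im p)\<^sup>2 \<le> d * (Im z)\<^sup>2 \<or> d * (Im p)\<^sup>2 \<le> d * (Im w)\<^sup>2"
      using Im z(1) w(1) \<open>0 < Im p\<close>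
      by (cases "0 \<le> d")
         (auto simp: closed_segment_eq_real_ivl upper_half_plane_def mult_le_cancel_left
               split: if_splits)
    ultimately show ?thesis
      using True z w by (auto simp: upper_half_plane_def)
  next
    case False
    then obtain c r :: real where pp: "p \<in> upper_half_plane"
      and seg: "Re p \<in> closed_segment (Re z) (Re w)"
      and on: "{z, w, p} \<subseteq> sphere (complex_of_real c) r"
      using p by (auto simp: hgeodesic_def)
    have Im: "(Im q)\<^sup>2 = r\<^sup>2 - (Re q - c)\<^sup>2" if "q \<in> {z, w, p}" for q
    proof -
      have "r = cmod (complex_of_real c - q)"
        using on that by (auto simp: dist_norm)
      then have "r\<^sup>2 = (c - Re q)\<^sup>2 + (Im q)\<^sup>2"
        by (simp add: cmod_power2)
      then show ?thesis
        by (simp add: power2_commute)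
    qed
    obtain s where s: "0 \<le> s" "s \<le> 1" and Re: "Re p = (1 - s) * Re z + s * Re w"
      using seg by (auto simp: in_segment)
    \<comment> \<open>On the circle \<open>?f\<close> is quadratic in the real part with leading
      coefficient \<open>a - d\<close>, so it differs from linear interpolation exactly by the last
      term.\<close>
    have "?f p = (1 - s) * ?f z + s * ?f w - (a - d) * (s * (1 - s)) * (Re z - Re w)\<^sup>2"
      unfolding Im[of z, simplified] Im[of w, simplified] Im[of p, simplified] Re
      by (simp add: power2_eq_square algebra_simps)
    also have "\<dots> \<le> 0"
    proof -
      have "(1 - s) * ?f z \<le> 0" "s * ?f w \<le> 0"
        using s z(2) w(2) by (simp_all add: mult_nonneg_nonpos)
      moreover have "0 \<le> (a - d) * (s * (1 - s)) * (Re z - Re w)\<^sup>2"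
        using s assms by simp
      ultimately show ?thesis by linarith
    qed
    finally show ?thesis using pp by simp
  qed
  then show "p \<in> {z \<in> upper_half_plane. ?f z \<le> 0}" by simp
qed

text \<open>For \<open>d \<noteq> 0\<close> the condition on \<open>m\<close> says that the boundary
  curve has a point above \<open>m\<close>; for \<open>d = 0\<close>, that the vertical line over
  \<open>m\<close> avoids the region.\<close>

lemma not_hconvex_sublevel:
  fixes a b d e m :: real
  assumes "a < d"
    and m: "if d = 0 then 0 < a * m\<^sup>2 + 2 * b * m + e else d * (a * m\<^sup>2 + 2 * b * m + e) < 0"
  shows "\<not> hconvex {z \<in> upper_half_plane. a * (Re z)\<^sup>2 + d * (Im z)\<^sup>2 + 2 * b * Re z + e \<le> 0}"
    (is "\<not> hconvex ?R")
proof
  assume hconvex: "hconvex ?R"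
  show False
  proof (cases "d = 0")
    case True
    \<comment> \<open>The region is a union of vertical lines here. \<open>q\<close> is the vertex
      of a concave parabola, which is positive there since it is positive at \<open>m\<close>;
      \<open>t\<close> is large enough to make it nonpositive at \<open>q - t\<close> and
      \<open>q + t\<close>.\<close>
    define q where "q = - b / a"
    define t where "t = 1 + \<bar>a * q\<^sup>2 + 2 * b * q + e\<bar> / \<bar>a\<bar>"
    have "a < 0" and b: "b = - (a * q)"
      using assms True by (simp_all add: q_def)
    have "0 < a * m\<^sup>2 + 2 * b * m + e"
      using m True by simp
    also have "\<dots> = a * q\<^sup>2 + 2 * b * q + e + a * (m - q)\<^sup>2"
      unfolding b by (simp add: power2_eq_square algebra_simps)
    also have "\<dots> \<le> a * q\<^sup>2 + 2 * b * q + e"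
      using \<open>a < 0\<close> by (simp add: mult_nonpos_nonneg)
    finally have pos: "0 < a * q\<^sup>2 + 2 * b * q + e" .
    have t: "1 \<le> t"
      by (simp add: t_def)
    have "a * t\<^sup>2 \<le> a * t"
      using t \<open>a < 0\<close> by (simp add: mult_le_cancel_left power2_eq_square)
    also have "\<dots> = a - (a * q\<^sup>2 + 2 * b * q + e)"
      using pos \<open>a < 0\<close> by (simp add: t_def field_simps)
    finally have le: "a * q\<^sup>2 + 2 * b * q + e + a * t\<^sup>2 \<le> 0"
      using \<open>a < 0\<close> by linarith
    have "a * (q - t)\<^sup>2 + 2 * b * (q - t) + e = a * q\<^sup>2 + 2 * b * q + e + a * t\<^sup>2"
      "a * (q + t)\<^sup>2 + 2 * b * (q + t) + e = a * q\<^sup>2 + 2 * b * q + e + a * t\<^sup>2"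
      unfolding b by (simp_all add: power2_eq_square algebra_simps)
    then have "Complex (q - t) 1 \<in> ?R" "Complex (q + t) 1 \<in> ?R"
      using le True by (simp_all add: upper_half_plane_def)
    from hconvex_midpoint[OF hconvex this] t have "a * q\<^sup>2 + 2 * b * q + e \<le> 0"
      using True by simp
    with pos show False by simp
  next
    case False
    \<comment> \<open>\<open>Y\<close> is the value of \<open>y\<^sup>2\<close> on the boundary
      curve at \<open>x = m\<close>, and \<open>- k\<close> is its derivative in \<open>x\<close>.
      The bound \<open>t \<le> 1\<close> gives \<open>t\<^sup>2 \<le> t\<close>, and the summand 1
      in the denominator makes the estimate \<open>small\<close> strict.\<close>
    define Y where "Y = - (a * m\<^sup>2 + 2 * b * m + e) / d"
    define k where "k = 2 * (b + a * m) / d"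
    define t where "t = min 1 (Y / (\<bar>k\<bar> + \<bar>a / d\<bar> + 1))"
    have Y: "0 < Y"
      using m False by (auto simp: Y_def mult_less_0_iff intro: divide_pos_pos divide_neg_neg)
    have dY: "d * Y = - (a * m\<^sup>2 + 2 * b * m + e)" and dk: "d * k = 2 * (b + a * m)"
      using False by (simp_all add: Y_def k_def)
    have t: "0 < t" "t \<le> 1" and "t \<le> Y / (\<bar>k\<bar> + \<bar>a / d\<bar> + 1)"
      using Y by (simp_all add: t_def add_nonneg_pos)
    then have tY: "t * (\<bar>k\<bar> + \<bar>a / d\<bar> + 1) \<le> Y"
      by (simp add: pos_le_divide_eq add_nonneg_pos)
    have small: "\<bar>t * k\<bar> + \<bar>t\<^sup>2 * (a / d)\<bar> < Y"
    proof -
      have "t\<^sup>2 * \<bar>a / d\<bar> \<le> t * \<bar>a / d\<bar>"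
        using t by (intro mult_right_mono) (simp_all add: power2_eq_square mult_le_cancel_left1)
      then show ?thesis
        using t tY by (simp add: abs_mult distrib_left)
    qed
    \<comment> \<open>\<open>u\<close> and \<open>v\<close> are the values of \<open>y\<^sup>2\<close> on the boundary curve at \<open>x = m - t\<close> and \<open>x = m + t\<close>.\<close>
    define u where "u = Y - t\<^sup>2 * (a / d) + t * k"
    define v where "v = Y - t\<^sup>2 * (a / d) - t * k"
    have uv: "0 < u" "0 < v"
      using small unfolding u_def v_def by linarith+
    have du: "d * u = d * Y - t\<^sup>2 * a + t * (d * k)" and dv: "d * v = d * Y - t\<^sup>2 * a - t * (d * k)"
      using False by (simp_all add: u_def v_def algebra_simps)
    have "Complex (m - t) (sqrt u) \<in> ?R" "Complex (m + t) (sqrt v) \<in> ?R"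
      using uv unfolding upper_half_plane_def
      by (simp_all add: du dv dk dY) (simp_all add: power2_eq_square algebra_simps)
    \<comment> \<open>The first-order terms \<open>t * k\<close> cancel in \<open>u + v\<close>, and
      at the midpoint the form takes the value \<open>(d - a) * t\<^sup>2\<close>, which is
      positive.\<close>
    from hconvex_midpoint[OF hconvex this \<open>0 < t\<close>]
    have "a * m\<^sup>2 + d * ((u + v) / 2 + t\<^sup>2) + 2 * b * m + e \<le> 0"
      using uv by simp
    moreover have "d * ((u + v) / 2 + t\<^sup>2) = d * Y - t\<^sup>2 * a + d * t\<^sup>2"
      using du dv by (simp add: algebra_simps add_divide_distrib)
    ultimately have "(d - a) * t\<^sup>2 \<le> 0"
      using dY unfolding left_diff_distrib by (simp add: mult.commute)
    with \<open>a < d\<close> t show False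
      by (simp add: mult_le_0_iff)
  qed
qed

text \<open>An eigenvector for \<open>k \<noteq> d\<close> has middle entry 0, so it is a vector on which the form
  \<open>a x\<^sup>2 + 2 b x w + e w\<^sup>2\<close> has the sign of \<open>k\<close>; the last step is to achieve \<open>w = 1\<close>.\<close>

lemma eigenvalue_sign_attained:
  fixes a b d e k :: real
  assumes "eigenvalue (mat_of_rows_list 3 [[a, 0, b], [0, d, 0], [b, 0, e]]) k"
    and "k \<noteq> d" and "k \<noteq> 0"
  obtains m where "0 < k * (a * m\<^sup>2 + 2 * b * m + e)"
proof -
  let ?M = "mat_of_rows_list 3 [[a, 0, b], [0, d, 0], [b, 0, e]]"
  obtain v where v: "v \<in> carrier_vec 3" "v \<noteq> 0\<^sub>v 3" and eq: "?M *\<^sub>v v = k \<cdot>\<^sub>v v"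
    using assms(1) unfolding eigenvalue_def eigenvector_def
    by (auto simp: mat_of_rows_list_def numeral_3_eq_3)
  have row: "(?M *\<^sub>v v) $ i = k * v $ i" if "i < 3" for i
    using eq v that by simp
  have "a * v $ 0 + b * v $ 2 = k * v $ 0" "d * v $ 1 = k * v $ 1" "b * v $ 0 + e * v $ 2 = k * v $ 2"
    using row[of 0] row[of 1] row[of 2] v(1)
    by (simp_all add: mat_of_rows_list_def scalar_prod_def numeral_3_eq_3 numeral_2_eq_2)
  then have v1: "v $ 1 = 0" and eq0: "a * v $ 0 + b * v $ 2 = k * v $ 0"
    and eq2: "b * v $ 0 + e * v $ 2 = k * v $ 2"
    using \<open>k \<noteq> d\<close> by auto
  have nz: "v $ 0 \<noteq> 0 \<or> v $ 2 \<noteq> 0"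
  proof (rule ccontr)
    assume "\<not> ?thesis"
    then have "v $ i = 0" if "i < 3" for i
      using v1 that by (auto simp: less_Suc_eq numeral_3_eq_3 numeral_2_eq_2)
    with v show False by (auto intro!: eq_vecI)
  qed
  show thesis
  proof (cases "v $ 2 = 0")
    case True
    with nz eq0 eq2 have "a = k" "b = 0" by auto
    \<comment> \<open>The eigenvector is a multiple of the first unit vector, so
      \<open>w = 1\<close> is reached by taking \<open>m\<close> so large that
      \<open>k * m\<^sup>2\<close> outweighs \<open>e\<close>.\<close>
    define m where "m = 1 + \<bar>e / k\<bar>"
    have "\<bar>e / k\<bar> < m\<^sup>2"
      using self_le_power[of m 2] by (simp add: m_def)
    then have "0 < k\<^sup>2 * (m\<^sup>2 + e / k)"
      using \<open>k \<noteq> 0\<close> by (intro mult_pos_pos) (simp, linarith)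
    then have "0 < k * (a * m\<^sup>2 + 2 * b * m + e)"
      using \<open>k \<noteq> 0\<close> \<open>a = k\<close> \<open>b = 0\<close> by (simp add: power2_eq_square algebra_simps)
    then show thesis by (rule that)
  next
    case False
    \<comment> \<open>Scaling the eigenvector to last entry 1 turns the form into
      \<open>k * (m\<^sup>2 + 1)\<close>.\<close>
    define m where "m = v $ 0 / v $ 2"
    have "a * m + b = k * m" "b * m + e = k"
      using eq0 eq2 False by (simp_all add: m_def field_simps)
    have "k * (a * m\<^sup>2 + 2 * b * m + e) = k * (m * (a * m + b) + (b * m + e))"
      by (simp add: power2_eq_square algebra_simps)
    also have "\<dots> = k\<^sup>2 * (m\<^sup>2 + 1)"
      unfolding \<open>a * m + b = k * m\<close> \<open>b * m + e = k\<close> by (simp add: power2_eq_square algebra_simps)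
    also have "0 < \<dots>"
      using \<open>k \<noteq> 0\<close> by (simp add: add_nonneg_pos)
    finally show thesis by (rule that)
  qed
qed

theorem theorem2:
  fixes \<theta>11 \<theta>13 \<theta>22 \<theta>33 :: real and \<Theta> :: "real mat"
  assumes "\<Theta> = mat_of_rows_list 3 [[\<theta>11, 0, \<theta>13],
                                     [0, \<theta>22, 0],
                                     [\<theta>13, 0, \<theta>33]]"
    and "indefinite \<Theta>"
  shows "hconvex (C_region \<Theta>) \<longleftrightarrow> \<theta>11 \<ge> \<theta>22"
proof -
  have C: "C_region \<Theta> =
    {z \<in> upper_half_plane. \<theta>11 * (Re z)\<^sup>2 + \<theta>22 * (Im z)\<^sup>2 + 2 * \<theta>13 * Re z + \<theta>33 \<le> 0}"
    unfolding C_region_def assms(1) by (simp add: mat_of_rows_list_def numeral_2_eq_2)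
  have "\<not> hconvex (C_region \<Theta>)" if less: "\<theta>11 < \<theta>22"
  proof -
    obtain k l where k: "eigenvalue \<Theta> k" "0 < k" and l: "eigenvalue \<Theta> l" "l < 0"
      using assms(2) unfolding indefinite_def by blast
    obtain m where "if \<theta>22 = 0 then 0 < \<theta>11 * m\<^sup>2 + 2 * \<theta>13 * m + \<theta>33
      else \<theta>22 * (\<theta>11 * m\<^sup>2 + 2 * \<theta>13 * m + \<theta>33) < 0"
    \<comment> \<open>An eigenvalue whose sign is not that of \<open>\<theta>22\<close> differs from
      \<open>\<theta>22\<close>, hence belongs to the block of the other two coordinates.\<close>
    proof (cases "0 < \<theta>22")
      case True
      with l obtain m where "0 < l * (\<theta>11 * m\<^sup>2 + 2 * \<theta>13 * m + \<theta>33)"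
        using eigenvalue_sign_attained[of \<theta>11 \<theta>13 \<theta>22 \<theta>33 l] assms(1) by auto
      then show thesis
        using True l by (intro that[of m]) (auto simp: zero_less_mult_iff mult_less_0_iff)
    next
      case False
      with k obtain m where "0 < k * (\<theta>11 * m\<^sup>2 + 2 * \<theta>13 * m + \<theta>33)"
        using eigenvalue_sign_attained[of \<theta>11 \<theta>13 \<theta>22 \<theta>33 k] assms(1) by auto
      then show thesis
        using False k by (intro that[of m]) (auto simp: zero_less_mult_iff mult_less_0_iff)
    qed
    from not_hconvex_sublevel[OF less this] show ?thesis
      unfolding C .
  qed
  then show ?thesis
    using sublevel_hconvex[of \<theta>22 \<theta>11 \<theta>13 \<theta>33] unfolding C by force
qed

end
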